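(* The set of maps $f\in\mathcal C(\{0,1\}^{\mathbb N})$ such that $f$ is chain continuous at every point of $\{0,1\}^{\mathbb N}$ is comeager in $\mathcal C(\{0,1\}^{\mathbb N})$.
   Context: $\{0,1\}^{\mathbb N}$ ($\mathbb N$ the positive integers) has the product topology and the metric $d(\sigma,\tau)=1/n$, where $n$ is the least positive integer with $\sigma(n)\neq\tau(n)$, and $d(\sigma,\sigma)=0$. $\mathcal C(\{0,1\}^{\mathbb N})$ is the space of all continuous self-maps of $\{0,1\}^{\mathbb N}$ with the metric $\tilde d(f,g)=\max_\sigma d(f(\sigma),g(\sigma))$. A self-map $f$ of a metric space $X$ is chain continuous at $x\in X$ if for every $\epsilon>0$ there is $\delta>0$ such that for any choice of points $x_0\in B(x;\delta)$, $x_1\in B(f(x_0);\delta)$, $x_2\in B(f(x_1);\delta),\dots$ one has $d(x_n,f^n(x))<\epsilon$ for every $n\ge0$. Here $B(y;\delta)$ is the open ball of center $y$ and radius $\delta$. *)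

theory Defs
  imports "HOL-Analysis.Analysis"
begin

section \<open>The Cantor space\<close>

text \<open>
  A point of the Cantor space is a function \<open>\<sigma> :: nat \<Rightarrow> bool\<close>, with \<open>False\<close> and \<open>True\<close> for the
  digits 0 and 1.  Coordinates start at 0 here, so the \<open>n\<close>-th coordinate for a positive integer
  \<open>n\<close> is \<open>\<sigma> (n - 1)\<close>; this is the origin of the successor in the metric.  The topology that
  the type class instances put on \<open>nat \<Rightarrow> bool\<close> is the product of the discrete topologies, but the
  metric \<open>dist\<close> of the instance for functions is not the metric used here.
\<close>

definition cantor_dist :: "(nat \<Rightarrow> bool) \<Rightarrow> (nat \<Rightarrow> bool) \<Rightarrow> real" where
  "cantor_dist \<sigma> \<tau> = (if \<sigma> = \<tau> then 0 else 1 / real (Suc (LEAST n. \<sigma> n \<noteq> \<tau> n)))"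

lemma cantor_dist_less_iff:
  "cantor_dist \<sigma> \<tau> < 1 / real (Suc k) \<longleftrightarrow> (\<forall>n\<le>k. \<sigma> n = \<tau> n)"
proof (cases "\<sigma> = \<tau>")
  case False
  then have ex: "\<exists>n. \<sigma> n \<noteq> \<tau> n" by auto
  define m where "m = (LEAST n. \<sigma> n \<noteq> \<tau> n)"
  have m: "\<sigma> m \<noteq> \<tau> m" "\<And>n. n < m \<Longrightarrow> \<sigma> n = \<tau> n"
    unfolding m_def using LeastI_ex[OF ex] not_less_Least[of _ "\<lambda>n. \<sigma> n \<noteq> \<tau> n"] by blast+
  have "cantor_dist \<sigma> \<tau> < 1 / real (Suc k) \<longleftrightarrow> k < m"
    using False by (auto simp: cantor_dist_def m_def field_simps)
  also have "\<dots> \<longleftrightarrow> (\<forall>n\<le>k. \<sigma> n = \<tau> n)"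
    using m by (meson le_less_trans linorder_not_less)
  finally show ?thesis .
qed (simp add: cantor_dist_def)

lemma cantor_dist_nonneg: "0 \<le> cantor_dist \<sigma> \<tau>"
  and cantor_dist_le_1: "cantor_dist \<sigma> \<tau> \<le> 1"
  and cantor_dist_eq_0: "cantor_dist \<sigma> \<tau> = 0 \<longleftrightarrow> \<sigma> = \<tau>"
  by (auto simp: cantor_dist_def)

lemma cantor_dist_commute: "cantor_dist \<sigma> \<tau> = cantor_dist \<tau> \<sigma>"
proof -
  have *: "(\<lambda>n. \<sigma> n \<noteq> \<tau> n) = (\<lambda>n. \<tau> n \<noteq> \<sigma> n)"
    by (rule ext) (rule neq_commute)
  show ?thesis
    unfolding cantor_dist_def by (rule if_cong) (rule eq_commute refl | simp only: *)+
qed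

lemma cantor_dist_cases: "cantor_dist \<sigma> \<tau> = 0 \<or> (\<exists>k. cantor_dist \<sigma> \<tau> = 1 / real (Suc k))"
  by (auto simp: cantor_dist_def)

lemma cantor_dist_ultra: "cantor_dist \<sigma> \<upsilon> \<le> max (cantor_dist \<sigma> \<tau>) (cantor_dist \<tau> \<upsilon>)"
proof (rule ccontr)
  assume *: "\<not> ?thesis"
  then have "cantor_dist \<sigma> \<upsilon> \<noteq> 0"
    using cantor_dist_nonneg[of \<sigma> \<tau>] by linarith
  then obtain k where k: "cantor_dist \<sigma> \<upsilon> = 1 / real (Suc k)"
    using cantor_dist_cases[of \<sigma> \<upsilon>] by blast
  have "cantor_dist \<sigma> \<tau> < 1 / real (Suc k)" "cantor_dist \<tau> \<upsilon> < 1 / real (Suc k)"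
    using * unfolding k by linarith+
  then have "\<forall>n\<le>k. \<sigma> n = \<upsilon> n"
    unfolding cantor_dist_less_iff by simp
  then have "cantor_dist \<sigma> \<upsilon> < 1 / real (Suc k)"
    unfolding cantor_dist_less_iff .
  then show False unfolding k by simp
qed

lemma Metric_space_cantor: "Metric_space UNIV cantor_dist"
proof
  show "cantor_dist \<sigma> \<upsilon> \<le> cantor_dist \<sigma> \<tau> + cantor_dist \<tau> \<upsilon>" for \<sigma> \<tau> \<upsilon>
    using cantor_dist_ultra[of \<sigma> \<upsilon> \<tau>] cantor_dist_nonneg[of \<sigma> \<tau>] cantor_dist_nonneg[of \<tau> \<upsilon>]
    by linarith
  show "0 \<le> cantor_dist \<sigma> \<tau>" for \<sigma> \<tau>
    by (rule cantor_dist_nonneg)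
  show "cantor_dist \<sigma> \<tau> = cantor_dist \<tau> \<sigma>" for \<sigma> \<tau>
    by (rule cantor_dist_commute)
  show "cantor_dist \<sigma> \<tau> = 0 \<longleftrightarrow> \<sigma> = \<tau>" for \<sigma> \<tau>
    by (rule cantor_dist_eq_0)
qed

lemma open_cantor_cylinder: "open {\<tau> :: nat \<Rightarrow> bool. \<forall>n\<le>k. \<sigma> n = \<tau> n}"
proof -
  have "open ((\<lambda>\<tau>. \<tau> n) -` {\<sigma> n} :: (nat \<Rightarrow> bool) set)" for n
    by (rule open_vimage[OF open_discrete continuous_on_product_coordinates])
  then have "open (\<Inter>n\<in>{..k}. (\<lambda>\<tau>. \<tau> n) -` {\<sigma> n} :: (nat \<Rightarrow> bool) set)"
    by (intro open_INT) auto
  also have "(\<Inter>n\<in>{..k}. (\<lambda>\<tau>. \<tau> n) -` {\<sigma> n}) = {\<tau>. \<forall>n\<le>k. \<sigma> n = \<tau> n}"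
    by auto
  finally show ?thesis .
qed

lemma mtopology_cantor: "Metric_space.mtopology UNIV cantor_dist = euclidean"
proof -
  interpret Metric_space UNIV cantor_dist by (rule Metric_space_cantor)
  have ball: "mball \<sigma> (1 / real (Suc k)) = {\<tau>. \<forall>n\<le>k. \<sigma> n = \<tau> n}" for \<sigma> k
    unfolding mball_def cantor_dist_less_iff by simp
  have "(\<forall>\<sigma>\<in>U. \<exists>r>0. mball \<sigma> r \<subseteq> U) \<longleftrightarrow> open U" for U
  proof
    assume L: "\<forall>\<sigma>\<in>U. \<exists>r>0. mball \<sigma> r \<subseteq> U"
    show "open U"
    proof (subst open_subopen, intro ballI)
      fix \<sigma> assume "\<sigma> \<in> U"
      with L obtain r where r: "r > 0" "mball \<sigma> r \<subseteq> U" by blast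
      obtain k where "1 / real (Suc k) < r" using r(1) nat_approx_posE by blast
      then have "{\<tau>. \<forall>n\<le>k. \<sigma> n = \<tau> n} \<subseteq> U"
        using r(2) mball_subset_concentric[of "1 / real (Suc k)" r \<sigma>] by (simp only: ball) auto
      then show "\<exists>T. open T \<and> \<sigma> \<in> T \<and> T \<subseteq> U"
        using open_cantor_cylinder[of k \<sigma>] by blast
    qed
  next
    assume U: "open U"
    show "\<forall>\<sigma>\<in>U. \<exists>r>0. mball \<sigma> r \<subseteq> U"
    proof
      fix \<sigma> assume "\<sigma> \<in> U"
      with U obtain X where X: "\<sigma> \<in> Pi\<^sub>E UNIV X" "finite {i. X i \<noteq> UNIV}" "Pi\<^sub>E UNIV X \<subseteq> U"
        unfolding open_fun_def using product_topology_open_contains_basis[of "\<lambda>_. euclidean" UNIV U \<sigma>]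
        by auto
      obtain k where k: "\<And>i. X i \<noteq> UNIV \<Longrightarrow> i \<le> k"
        using X(2) finite_nat_set_iff_bounded_le by auto
      have "{\<tau>. \<forall>n\<le>k. \<sigma> n = \<tau> n} \<subseteq> Pi\<^sub>E UNIV X"
      proof
        fix \<tau> assume "\<tau> \<in> {\<tau>. \<forall>n\<le>k. \<sigma> n = \<tau> n}"
        then have eq: "\<sigma> n = \<tau> n" if "n \<le> k" for n
          using that by blast
        have "\<tau> i \<in> X i" for i
        proof (cases "X i = UNIV")
          case False
          have "\<sigma> i \<in> X i" using X(1) by (simp add: PiE_iff)
          then show ?thesis using eq[OF k[OF False]] by (simp only:)
        qed simp
        then show "\<tau> \<in> Pi\<^sub>E UNIV X" by auto
      qed
      then have "mball \<sigma> (1 / real (Suc k)) \<subseteq> U" using X(3) ball by auto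
      then show "\<exists>r>0. mball \<sigma> r \<subseteq> U" by (meson of_nat_0_less_iff zero_less_Suc zero_less_divide_1_iff)
    qed
  qed
  then show ?thesis
    by (auto simp: topology_eq openin_mtopology)
qed


section \<open>The space of continuous self-maps of the Cantor space\<close>

definition cantor_maps :: "((nat \<Rightarrow> bool) \<Rightarrow> (nat \<Rightarrow> bool)) set" where
  "cantor_maps = {f. continuous_on UNIV f}"

text \<open>The supremum is a maximum, see \<open>cantor_maps_dist_attained\<close>.\<close>

definition cantor_maps_dist ::
  "((nat \<Rightarrow> bool) \<Rightarrow> (nat \<Rightarrow> bool)) \<Rightarrow> ((nat \<Rightarrow> bool) \<Rightarrow> (nat \<Rightarrow> bool)) \<Rightarrow> real" where
  "cantor_maps_dist f g = (SUP \<sigma>. cantor_dist (f \<sigma>) (g \<sigma>))"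

lemma cantor_dist_le_maps_dist: "cantor_dist (f \<sigma>) (g \<sigma>) \<le> cantor_maps_dist f g"
  unfolding cantor_maps_dist_def
  by (rule cSUP_upper) (auto intro!: bdd_aboveI2[where M = 1] cantor_dist_le_1)

lemma cantor_maps_dist_attained: "\<exists>\<sigma>. cantor_maps_dist f g = cantor_dist (f \<sigma>) (g \<sigma>)"
proof -
  define S where "S = range (\<lambda>\<sigma>. cantor_dist (f \<sigma>) (g \<sigma>))"
  have "\<exists>v\<in>S. \<forall>w\<in>S. w \<le> v"
  proof (cases "\<exists>\<sigma>. f \<sigma> \<noteq> g \<sigma>")
    case False
    then show ?thesis by (auto simp: S_def cantor_dist_eq_0[THEN iffD2])
  next
    case True
    then obtain \<sigma> where "f \<sigma> \<noteq> g \<sigma>" by blast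
    then have ex: "\<exists>k. 1 / real (Suc k) \<in> S"
      using cantor_dist_cases[of "f \<sigma>" "g \<sigma>"] unfolding S_def
      by (metis cantor_dist_eq_0 rangeI)
    define k where "k = (LEAST k. 1 / real (Suc k) \<in> S)"
    have k: "1 / real (Suc k) \<in> S" "\<And>j. 1 / real (Suc j) \<in> S \<Longrightarrow> k \<le> j"
      unfolding k_def by (rule LeastI_ex[OF ex], rule Least_le)
    have "w \<le> 1 / real (Suc k)" if w: "w \<in> S" for w
    proof -
      have "w = 0 \<or> (\<exists>j. w = 1 / real (Suc j))"
        using w cantor_dist_cases unfolding S_def by blast
      then show ?thesis
      proof
        assume "\<exists>j. w = 1 / real (Suc j)"
        then obtain j where j: "w = 1 / real (Suc j)" by blast
        with w k(2)[of j] have "k \<le> j" by simp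
        then show ?thesis unfolding j by (simp add: field_simps)
      qed simp
    qed
    then show ?thesis using k(1) by blast
  qed
  then obtain \<sigma> where "\<forall>\<tau>. cantor_dist (f \<tau>) (g \<tau>) \<le> cantor_dist (f \<sigma>) (g \<sigma>)"
    by (auto simp: S_def)
  then have "cantor_maps_dist f g \<le> cantor_dist (f \<sigma>) (g \<sigma>)"
    unfolding cantor_maps_dist_def by (intro cSUP_least) auto
  then show ?thesis using cantor_dist_le_maps_dist[of f \<sigma> g] by (metis order_antisym)
qed

lemma Metric_space_cantor_maps: "Metric_space cantor_maps cantor_maps_dist"
proof
  interpret Metric_space UNIV cantor_dist by (rule Metric_space_cantor)
  fix f g h
  show "0 \<le> cantor_maps_dist f g"
    using cantor_dist_nonneg cantor_dist_le_maps_dist order_trans by blast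
  show "cantor_maps_dist f g = cantor_maps_dist g f"
    unfolding cantor_maps_dist_def by (simp add: commute)
  show "cantor_maps_dist f g = 0 \<longleftrightarrow> f = g"
    using cantor_maps_dist_attained[of f g] cantor_dist_le_maps_dist[of f _ g]
      cantor_dist_nonneg cantor_dist_eq_0 by (metis ext order_antisym)
  obtain \<sigma> where "cantor_maps_dist f h = cantor_dist (f \<sigma>) (h \<sigma>)"
    using cantor_maps_dist_attained by blast
  then show "cantor_maps_dist f h \<le> cantor_maps_dist f g + cantor_maps_dist g h"
    using triangle[of "f \<sigma>" "g \<sigma>" "h \<sigma>"] cantor_dist_le_maps_dist[of f \<sigma> g]
      cantor_dist_le_maps_dist[of g \<sigma> h] by simp
qed


section \<open>Chain continuity\<close>

text \<open>\<open>f\<close> is meant to map the carrier \<open>M\<close> into itself.\<close>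

definition (in Metric_space) chain_continuous_at :: "('a \<Rightarrow> 'a) \<Rightarrow> 'a \<Rightarrow> bool" where
  "chain_continuous_at f x \<longleftrightarrow>
    (\<forall>\<epsilon>>0. \<exists>\<delta>>0. \<forall>y :: nat \<Rightarrow> 'a.
      y 0 \<in> mball x \<delta> \<and> (\<forall>n. y (Suc n) \<in> mball (f (y n)) \<delta>) \<longrightarrow>
      (\<forall>n. d (y n) ((f ^^ n) x) < \<epsilon>))"


section \<open>Baire category\<close>

definition nowhere_dense_in :: "'a topology \<Rightarrow> 'a set \<Rightarrow> bool" where
  "nowhere_dense_in X A \<longleftrightarrow> A \<subseteq> topspace X \<and> X interior_of (X closure_of A) = {}"

definition meager_in :: "'a topology \<Rightarrow> 'a set \<Rightarrow> bool" where
  "meager_in X = countable union_of nowhere_dense_in X"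

definition comeager_in :: "'a topology \<Rightarrow> 'a set \<Rightarrow> bool" where
  "comeager_in X A \<longleftrightarrow> A \<subseteq> topspace X \<and> meager_in X (topspace X - A)"

end

theory Submission
  imports Defs
begin

text \<open>
  Say that a map \<open>f\<close> respects level \<open>n\<close> if the coordinates \<open>0, \<dots>, n\<close> of \<open>f \<sigma>\<close> depend only on
  the coordinates \<open>0, \<dots>, n\<close> of \<open>\<sigma>\<close>, so that \<open>f\<close> induces a self-map of the finite set of words of
  length \<open>n + 1\<close>.  An error smaller than \<open>1 / (n + 1)\<close> does not change such a word.  Hence a
  pseudo-orbit of \<open>f\<close> with errors smaller than \<open>1 / (n + 1)\<close> has, at every time, the same word as
  the true orbit: the errors do not accumulate, and the two stay closer than \<open>1 / (n + 1)\<close>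
  forever.  A map that respects arbitrarily large levels is therefore chain continuous everywhere
  (\<open>chain_continuous_at_if_respects_levels\<close>).

  Respecting some level \<open>n \<ge> k\<close> is an open condition, because it concerns only the first
  coordinates of the values and these are stable under small perturbations of \<open>f\<close>
  (\<open>open_respects_level\<close>).  It is also a dense condition
  (\<open>exists_near_map_respecting_level\<close>): given \<open>g\<close> and \<open>m\<close>, uniform continuity provides \<open>n \<ge> m\<close>
  such that the coordinates up to \<open>n\<close> of \<open>\<sigma>\<close> determine those up to \<open>m\<close> of \<open>g \<sigma>\<close>.  Erasing all
  later coordinates of \<open>g \<sigma>\<close> moves \<open>g\<close> by less than \<open>1 / (m + 1)\<close> and leaves nothing else to be
  determined, so the new map respects level \<open>n\<close>.  The intersection over \<open>k\<close> of these open dense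
  sets consists of chain continuous maps.
\<close>

section \<open>Maps that respect a level\<close>

definition agree_upto :: "nat \<Rightarrow> (nat \<Rightarrow> bool) \<Rightarrow> (nat \<Rightarrow> bool) \<Rightarrow> bool" where
  "agree_upto n \<sigma> \<tau> \<longleftrightarrow> (\<forall>i\<le>n. \<sigma> i = \<tau> i)"

definition respects_level :: "nat \<Rightarrow> ((nat \<Rightarrow> bool) \<Rightarrow> (nat \<Rightarrow> bool)) \<Rightarrow> bool" where
  "respects_level n f \<longleftrightarrow> (\<forall>\<sigma> \<tau>. agree_upto n \<sigma> \<tau> \<longrightarrow> agree_upto n (f \<sigma>) (f \<tau>))"

lemma agree_upto_refl: "agree_upto n \<sigma> \<sigma>"
  by (simp add: agree_upto_def)

lemma agree_upto_sym: "agree_upto n \<sigma> \<tau> \<Longrightarrow> agree_upto n \<tau> \<sigma>"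
  by (simp add: agree_upto_def)

lemma agree_upto_trans: "agree_upto n \<sigma> \<tau> \<Longrightarrow> agree_upto n \<tau> \<upsilon> \<Longrightarrow> agree_upto n \<sigma> \<upsilon>"
  by (simp add: agree_upto_def)

lemma agree_upto_mono: "agree_upto n \<sigma> \<tau> \<Longrightarrow> m \<le> n \<Longrightarrow> agree_upto m \<sigma> \<tau>"
  by (simp add: agree_upto_def)

lemma cantor_dist_less_iff_agree: "cantor_dist \<sigma> \<tau> < 1 / real (Suc n) \<longleftrightarrow> agree_upto n \<sigma> \<tau>"
  unfolding agree_upto_def by (rule cantor_dist_less_iff)

lemma cantor_maps_dist_less_iff_agree:
  "cantor_maps_dist f g < 1 / real (Suc n) \<longleftrightarrow> (\<forall>\<sigma>. agree_upto n (f \<sigma>) (g \<sigma>))"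
  using cantor_maps_dist_attained[of f g] cantor_dist_le_maps_dist[of f _ g]
  unfolding cantor_dist_less_iff_agree[symmetric] by (metis order_le_less_trans)


section \<open>Chain continuity\<close>

text \<open>
  By induction along the chain: each step of \<open>f\<close> maps equal words of length \<open>n + 1\<close> to equal words,
  and the error made at that step does not reach the first \<open>n + 1\<close> coordinates.
\<close>

lemma agree_upto_pseudo_orbit:
  assumes f: "respects_level n f"
    and y0: "agree_upto n x (y 0)"
    and step: "\<And>j. agree_upto n (f (y j)) (y (Suc j))"
  shows "agree_upto n (y j) ((f ^^ j) x)"
proof (induction j)
  case 0
  show ?case using agree_upto_sym[OF y0] by simp
next
  case (Suc j)
  have "agree_upto n (f (y j)) (f ((f ^^ j) x))"
    using f Suc.IH unfolding respects_level_def by blast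
  then show ?case
    using agree_upto_trans[OF agree_upto_sym[OF step]] by simp
qed

lemma chain_continuous_at_if_respects_levels:
  assumes "\<And>k. \<exists>n\<ge>k. respects_level n f"
  shows "Metric_space.chain_continuous_at UNIV cantor_dist f x"
proof -
  interpret Metric_space UNIV cantor_dist by (rule Metric_space_cantor)
  show ?thesis
    unfolding chain_continuous_at_def
  proof (intro allI impI)
    fix \<epsilon> :: real
    assume "\<epsilon> > 0"
    then obtain k where k: "1 / real (Suc k) < \<epsilon>"
      using nat_approx_posE by blast
    obtain n where n: "n \<ge> k" "respects_level n f"
      using assms by blast
    have "cantor_dist (y j) ((f ^^ j) x) < \<epsilon>"
      if "y 0 \<in> mball x (1 / real (Suc n)) \<and> (\<forall>j. y (Suc j) \<in> mball (f (y j)) (1 / real (Suc n)))"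
      for y j
    proof -
      have "agree_upto n (y j) ((f ^^ j) x)"
        using that agree_upto_pseudo_orbit[OF n(2), of x y]
        by (simp only: in_mball UNIV_I simp_thms cantor_dist_less_iff_agree)
      then have "cantor_dist (y j) ((f ^^ j) x) < 1 / real (Suc k)"
        using agree_upto_mono[OF _ n(1)] cantor_dist_less_iff_agree by blast
      then show ?thesis using k by linarith
    qed
    then show "\<exists>\<delta>>0. \<forall>y. y 0 \<in> mball x \<delta> \<and> (\<forall>n. y (Suc n) \<in> mball (f (y n)) \<delta>) \<longrightarrow>
        (\<forall>n. cantor_dist (y n) ((f ^^ n) x) < \<epsilon>)"
      by (intro exI[of _ "1 / real (Suc n)"]) simp
  qed
qed


section \<open>Openness and density\<close>

text \<open>Maps closer than \<open>1 / (n + 1)\<close> induce the same map on words of length \<open>n + 1\<close>.\<close>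

lemma respects_level_cong:
  assumes "respects_level n f" "\<And>\<sigma>. agree_upto n (f \<sigma>) (g \<sigma>)"
  shows "respects_level n g"
  using assms unfolding respects_level_def by (meson agree_upto_sym agree_upto_trans)

lemma open_respects_level:
  "openin (Metric_space.mtopology cantor_maps cantor_maps_dist)
    {f \<in> cantor_maps. \<exists>n\<ge>k. respects_level n f}"
proof -
  interpret Metric_space cantor_maps cantor_maps_dist by (rule Metric_space_cantor_maps)
  have "\<exists>r>0. mball f r \<subseteq> {f \<in> cantor_maps. \<exists>n\<ge>k. respects_level n f}"
    if n: "n \<ge> k" "respects_level n f" for f n
  proof (intro exI[of _ "1 / real (Suc n)"] conjI subsetI)
    fix g
    assume "g \<in> mball f (1 / real (Suc n))"
    then have g: "g \<in> cantor_maps" "\<And>\<sigma>. agree_upto n (f \<sigma>) (g \<sigma>)"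
      unfolding in_mball cantor_maps_dist_less_iff_agree by auto
    show "g \<in> {f \<in> cantor_maps. \<exists>n\<ge>k. respects_level n f}"
      using g(1) n(1) respects_level_cong[OF n(2) g(2)] by blast
  qed simp
  then show ?thesis
    unfolding openin_mtopology by blast
qed

lemma compact_space_cantor: "compact_space (euclidean :: (nat \<Rightarrow> bool) topology)"
proof -
  have "compact_space (euclidean :: bool topology)"
    by (simp add: compact_space_def finite_imp_compact)
  then show ?thesis
    by (simp add: euclidean_product_topology[symmetric] compact_space_product_topology)
qed

text \<open>Uniform continuity on the compact Cantor space, in terms of words.\<close>

lemma finitely_many_coordinates_determine:
  assumes "f \<in> cantor_maps"
  obtains n where "\<And>\<sigma> \<tau>. agree_upto n \<sigma> \<tau> \<Longrightarrow> agree_upto m (f \<sigma>) (f \<tau>)"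
proof -
  interpret Metric_space UNIV cantor_dist by (rule Metric_space_cantor)
  have "uniformly_continuous_map (metric (UNIV, cantor_dist)) (metric (UNIV, cantor_dist)) f"
    using assms
    by (intro continuous_imp_uniformly_continuous_map)
      (simp_all add: mtopology_cantor compact_space_cantor cantor_maps_def)
  then obtain \<delta> where \<delta>: "\<delta> > 0"
    "\<And>\<sigma> \<tau>. cantor_dist \<sigma> \<tau> < \<delta> \<Longrightarrow> cantor_dist (f \<sigma>) (f \<tau>) < 1 / real (Suc m)"
    unfolding uniformly_continuous_map_def
    by simp (metis of_nat_0_less_iff of_nat_Suc zero_less_Suc zero_less_divide_1_iff)
  obtain n where n: "1 / real (Suc n) < \<delta>"
    using \<delta>(1) nat_approx_posE by blast
  have "agree_upto m (f \<sigma>) (f \<tau>)" if "agree_upto n \<sigma> \<tau>" for \<sigma> \<tau>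
    using \<delta>(2)[of \<sigma> \<tau>] n that unfolding cantor_dist_less_iff_agree[symmetric] by linarith
  then show thesis by (rule that)
qed

lemma exists_near_map_respecting_level:
  assumes g: "g \<in> cantor_maps"
  obtains f n where "f \<in> cantor_maps" "\<And>\<sigma>. agree_upto m (g \<sigma>) (f \<sigma>)"
    "n \<ge> k" "respects_level n f"
proof -
  obtain l where l: "\<And>\<sigma> \<tau>. agree_upto l \<sigma> \<tau> \<Longrightarrow> agree_upto m (g \<sigma>) (g \<tau>)"
    using finitely_many_coordinates_determine[OF g] by blast
  \<comment> \<open>Erasing the coordinates of \<open>g \<sigma>\<close> beyond \<open>m\<close> means setting them to \<open>False\<close>.\<close>
  define f where "f = (\<lambda>\<sigma> i. i \<le> m \<and> g \<sigma> i)"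
  have "continuous_on UNIV (\<lambda>\<sigma>. f \<sigma> i)" for i
  proof -
    have "continuous_on UNIV (\<lambda>\<sigma>. g \<sigma> i)"
      using g continuous_on_product_then_coordinatewise by (auto simp: cantor_maps_def)
    then show ?thesis
      by (cases "i \<le> m") (simp_all add: f_def)
  qed
  then have "f \<in> cantor_maps"
    by (auto simp: cantor_maps_def intro: continuous_on_coordinatewise_then_product)
  moreover have "agree_upto m (g \<sigma>) (f \<sigma>)" for \<sigma>
    by (simp add: agree_upto_def f_def)
  moreover have "respects_level (max k l) f"
    unfolding respects_level_def
  proof (intro allI impI)
    fix \<sigma> \<tau>
    assume "agree_upto (max k l) \<sigma> \<tau>"
    then have "agree_upto m (g \<sigma>) (g \<tau>)"
      using l agree_upto_mono by (meson max.cobounded2)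
    then show "agree_upto (max k l) (f \<sigma>) (f \<tau>)"
      by (auto simp: agree_upto_def f_def)
  qed
  ultimately show thesis
    using that[of f "max k l"] by simp
qed

lemma dense_respects_level:
  "Metric_space.mtopology cantor_maps cantor_maps_dist closure_of
    {f \<in> cantor_maps. \<exists>n\<ge>k. respects_level n f} = cantor_maps"
proof -
  interpret Metric_space cantor_maps cantor_maps_dist by (rule Metric_space_cantor_maps)
  have "\<exists>f\<in>{f \<in> cantor_maps. \<exists>n\<ge>k. respects_level n f}. f \<in> mball g r"
    if g: "g \<in> cantor_maps" and r: "r > 0" for g r
  proof -
    obtain m where m: "1 / real (Suc m) < r"
      using r nat_approx_posE by blast
    obtain f n where f: "f \<in> cantor_maps" "\<And>\<sigma>. agree_upto m (g \<sigma>) (f \<sigma>)"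
      "n \<ge> k" "respects_level n f"
      using exists_near_map_respecting_level[OF g] by metis
    have "cantor_maps_dist g f < 1 / real (Suc m)"
      unfolding cantor_maps_dist_less_iff_agree using f(2) by blast
    then have "f \<in> mball g r"
      using m f(1) g by simp
    then show ?thesis using f by blast
  qed
  then show ?thesis
    unfolding metric_closure_of by blast
qed


section \<open>Comeagerness\<close>

text \<open>
  The complement is covered by the nowhere dense complements of the sets \<open>U k\<close>.  It may be smaller
  than their union, hence the intersections with the complement in the proof.
\<close>

lemma comeager_in_if_Inter_open_dense:
  fixes U :: "nat \<Rightarrow> 'a set"
  assumes A: "A \<subseteq> topspace X"
    and U: "\<And>k. openin X (U k)" "\<And>k. X closure_of (U k) = topspace X"
    and sub: "(\<Inter>k. U k) \<subseteq> A"
  shows "comeager_in X A"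
proof -
  define N where "N k = topspace X - A - U k" for k
  have "nowhere_dense_in X (N k)" for k
  proof -
    have "X closure_of (N k) \<subseteq> topspace X - U k"
      by (rule closure_of_minimal) (use U(1) in \<open>auto simp: N_def\<close>)
    moreover have "X interior_of (topspace X - U k) = {}"
      using U(2) closure_of_eq_topspace by metis
    ultimately show ?thesis
      unfolding nowhere_dense_in_def N_def using interior_of_mono by blast
  qed
  moreover have "\<Union> (range N) = topspace X - A"
    using sub by (auto simp: N_def)
  ultimately have "meager_in X (topspace X - A)"
    unfolding meager_in_def union_of_def by (intro exI[of _ "range N"]) auto
  then show ?thesis
    using A by (simp add: comeager_in_def)
qed

theorem theorem5p3:
  shows "comeager_in (Metric_space.mtopology cantor_maps cantor_maps_dist)
    {f \<in> cantor_maps. \<forall>\<sigma>. Metric_space.chain_continuous_at UNIV cantor_dist f \<sigma>}"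
proof -
  interpret Metric_space cantor_maps cantor_maps_dist by (rule Metric_space_cantor_maps)
  show ?thesis
  proof (rule comeager_in_if_Inter_open_dense)
    show "openin mtopology {f \<in> cantor_maps. \<exists>n\<ge>k. respects_level n f}" for k
      by (rule open_respects_level)
    show "mtopology closure_of {f \<in> cantor_maps. \<exists>n\<ge>k. respects_level n f} = topspace mtopology"
      for k
      by (simp add: dense_respects_level)
    show "(\<Inter>k. {f \<in> cantor_maps. \<exists>n\<ge>k. respects_level n f})
      \<subseteq> {f \<in> cantor_maps. \<forall>\<sigma>. Metric_space.chain_continuous_at UNIV cantor_dist f \<sigma>}"
      using chain_continuous_at_if_respects_levels by blast
  qed auto
qed

end
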